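(* Let $X$ be a (locally) compact Hausdorff space and let $(C(X),\theta)$ be a commutative $\mathbb{Z}_2$-graded $C^*$-algebra, with the grading given by $f\mapsto f\circ\theta$ for an involutive homeomorphism of $X$ also denoted by $\theta$. Then the set of extreme even states of $(C(X),\theta)$, i.e. of extreme points of the convex set of its even states, is $$\left\{\tfrac12\big(\delta_x+\delta_{\theta(x)}\big): x\in X\right\}.$$
   Context: For $X$ compact, $C(X)$ is the $C^*$-algebra of continuous complex functions on $X$; for $X$ only locally compact, $C(X)$ is understood as the $C^*$-algebra of continuous functions on $X$ vanishing at infinity. A $\mathbb{Z}_2$-graded $C^*$-algebra is a $C^*$-algebra with a $*$-automorphism whose square is the identity. Every such automorphism of $C(X)$ has the form $f\mapsto f\circ\theta$ for a homeomorphism $\theta:X\to X$ with $\theta^2=\mathrm{id}_X$. A state is even if it is invariant under the grading automorphism. $\delta_x$ is the evaluation state $f\mapsto f(x)$. *)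

theory Defs
  imports "HOL-Analysis.Analysis"
begin

section \<open>Graded C*-algebras and their even states\<close>

text \<open>
  C*-algebras are not assumed unital. The complex vector space structure extends the real one of
  \<^class>\<open>real_normed_algebra\<close>.
\<close>

class cstar_algebra = real_normed_algebra + banach +
  fixes scaleC :: "complex \<Rightarrow> 'a \<Rightarrow> 'a"  (infixr "*\<^sub>C" 75)
    and star :: "'a \<Rightarrow> 'a"
  assumes scaleC_add_right: "c *\<^sub>C (a + b) = c *\<^sub>C a + c *\<^sub>C b"
    and scaleC_add_left: "(c + d) *\<^sub>C a = c *\<^sub>C a + d *\<^sub>C a"
    and scaleC_scaleC: "c *\<^sub>C d *\<^sub>C a = (c * d) *\<^sub>C a"
    and scaleC_of_real: "complex_of_real r *\<^sub>C a = r *\<^sub>R a"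
    and mult_scaleC_left: "(c *\<^sub>C a) * b = c *\<^sub>C (a * b)"
    and mult_scaleC_right: "a * (c *\<^sub>C b) = c *\<^sub>C (a * b)"
    and norm_scaleC: "norm (c *\<^sub>C a) = cmod c * norm a"
    and star_add: "star (a + b) = star a + star b"
    and star_scaleC: "star (c *\<^sub>C a) = cnj c *\<^sub>C star a"
    and star_mult: "star (a * b) = star b * star a"
    and star_star: "star (star a) = a"
    and norm_star_mult: "norm (star a * a) = (norm a)\<^sup>2"

definition star_automorphism :: "('a::cstar_algebra \<Rightarrow> 'a) \<Rightarrow> bool" where
  "star_automorphism \<gamma> \<longleftrightarrow> bij \<gamma> \<and>
     (\<forall>a b. \<gamma> (a + b) = \<gamma> a + \<gamma> b) \<and> (\<forall>c a. \<gamma> (c *\<^sub>C a) = c *\<^sub>C \<gamma> a) \<and>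
     (\<forall>a b. \<gamma> (a * b) = \<gamma> a * \<gamma> b) \<and> (\<forall>a. \<gamma> (star a) = star (\<gamma> a))"

definition Z2_grading :: "('a::cstar_algebra \<Rightarrow> 'a) \<Rightarrow> bool" where
  "Z2_grading \<gamma> \<longleftrightarrow> star_automorphism \<gamma> \<and> \<gamma> \<circ> \<gamma> = id"

text \<open>
  A state is a positive complex-linear functional of norm one, the norm being the operator norm on
  the type of bounded (a priori only real-linear) functionals.
\<close>

definition state :: "('a::cstar_algebra \<Rightarrow>\<^sub>L complex) \<Rightarrow> bool" where
  "state \<phi> \<longleftrightarrow> (\<forall>c a. blinfun_apply \<phi> (c *\<^sub>C a) = c * blinfun_apply \<phi> a) \<and>
     (\<forall>a. blinfun_apply \<phi> (star a * a) \<in> \<real>\<^sub>\<ge>\<^sub>0) \<and> norm \<phi> = 1"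

definition even_states :: "('a::cstar_algebra \<Rightarrow> 'a) \<Rightarrow> ('a \<Rightarrow>\<^sub>L complex) set" where
  "even_states \<gamma> = {\<phi>. state \<phi> \<and> (\<forall>a. blinfun_apply \<phi> (\<gamma> a) = blinfun_apply \<phi> a)}"

section \<open>Continuous functions vanishing at infinity\<close>

text \<open>
  If the space is compact, the second condition is void (take the whole space for \<open>K\<close>), so that
  all continuous functions are obtained.
\<close>

definition vanishing :: "('a::topological_space \<Rightarrow> complex) set" where
  "vanishing = {f. continuous_on UNIV f \<and>
     (\<forall>e>0. \<exists>K. compact K \<and> (\<forall>x. x \<notin> K \<longrightarrow> cmod (f x) < e))}"

lemma vanishing_zero: "(\<lambda>_. 0) \<in> vanishing"
  by (auto simp: vanishing_def intro!: exI[of _ "{}"])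

lemma vanishing_bounded: "f \<in> vanishing \<Longrightarrow> \<exists>B. \<forall>x. cmod (f x) \<le> B"
proof -
  assume f: "f \<in> vanishing"
  then obtain K where K: "compact K" "\<And>x. x \<notin> K \<Longrightarrow> cmod (f x) < 1"
    unfolding vanishing_def by (auto dest: spec[of _ 1])
  have "bounded (f ` K)"
    using f K(1) by (auto simp: vanishing_def intro!: compact_imp_bounded
        compact_continuous_image intro: continuous_on_subset)
  then obtain B where B: "\<And>x. x \<in> K \<Longrightarrow> cmod (f x) \<le> B"
    by (auto simp: bounded_iff)
  have "cmod (f x) \<le> max B 1" for x
    using B[of x] K(2)[of x] by (cases "x \<in> K") auto
  then show ?thesis by blast
qed

lemma vanishing_dominated:
  assumes "continuous_on UNIV h" "f \<in> vanishing" "g \<in> vanishing" "B > 0"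
    and "\<And>x. cmod (h x) \<le> B * (cmod (f x) + cmod (g x))"
  shows "h \<in> vanishing"
  unfolding vanishing_def
proof (safe intro!: assms(1))
  fix e :: real assume "e > 0"
  then have e: "e / (2 * B) > 0" using assms(4) by simp
  obtain K where K: "compact K" "\<And>x. x \<notin> K \<Longrightarrow> cmod (f x) < e / (2 * B)"
    using assms(2) e unfolding vanishing_def by blast
  obtain L where L: "compact L" "\<And>x. x \<notin> L \<Longrightarrow> cmod (g x) < e / (2 * B)"
    using assms(3) e unfolding vanishing_def by blast
  have "cmod (h x) < e" if "x \<notin> K \<union> L" for x
  proof -
    have "cmod (f x) + cmod (g x) < e / B"
      using K(2)[of x] L(2)[of x] that by (auto simp: field_simps)
    then have "B * (cmod (f x) + cmod (g x)) < e"
      using assms(4) by (simp add: field_simps)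
    then show ?thesis using assms(5)[of x] by linarith
  qed
  then show "\<exists>K. compact K \<and> (\<forall>x. x \<notin> K \<longrightarrow> cmod (h x) < e)"
    using K(1) L(1) by (intro exI[of _ "K \<union> L"]) auto
qed

lemma vanishing_continuous: "f \<in> vanishing \<Longrightarrow> continuous_on UNIV f"
  by (simp add: vanishing_def)

lemma vanishing_add: "f \<in> vanishing \<Longrightarrow> g \<in> vanishing \<Longrightarrow> (\<lambda>x. f x + g x) \<in> vanishing"
  by (rule vanishing_dominated[of _ f g 1])
    (auto intro!: continuous_intros norm_triangle_ineq dest: vanishing_continuous)

lemma vanishing_mult_bounded:
  assumes "f \<in> vanishing" "continuous_on UNIV g" "\<And>x. cmod (g x) \<le> B"
  shows "(\<lambda>x. g x * f x) \<in> vanishing"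
proof (rule vanishing_dominated[of _ f f "max B 1"])
  show "cmod (g x * f x) \<le> max B 1 * (cmod (f x) + cmod (f x))" for x
  proof -
    have "cmod (g x * f x) \<le> max B 1 * cmod (f x)"
      using assms(3)[of x] by (auto simp: norm_mult intro!: mult_right_mono)
    also have "\<dots> \<le> max B 1 * (cmod (f x) + cmod (f x))"
      by (intro mult_left_mono) auto
    finally show ?thesis .
  qed
qed (use assms in \<open>auto intro!: continuous_intros dest: vanishing_continuous\<close>)

lemma vanishing_mult: "f \<in> vanishing \<Longrightarrow> g \<in> vanishing \<Longrightarrow> (\<lambda>x. f x * g x) \<in> vanishing"
  using vanishing_bounded[of f] vanishing_mult_bounded[of g f] vanishing_continuous[of f] by blast

lemma vanishing_scale: "f \<in> vanishing \<Longrightarrow> (\<lambda>x. c * f x) \<in> vanishing"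
  by (rule vanishing_mult_bounded[of f "\<lambda>_. c" "cmod c"]) auto

lemma vanishing_minus: "f \<in> vanishing \<Longrightarrow> (\<lambda>x. - f x) \<in> vanishing"
  using vanishing_scale[of f "-1"] by simp

lemma vanishing_diff: "f \<in> vanishing \<Longrightarrow> g \<in> vanishing \<Longrightarrow> (\<lambda>x. f x - g x) \<in> vanishing"
  using vanishing_add[OF _ vanishing_minus, of f g] by simp

lemma vanishing_cnj: "f \<in> vanishing \<Longrightarrow> (\<lambda>x. cnj (f x)) \<in> vanishing"
  by (rule vanishing_dominated[of _ f f 1])
    (auto intro!: continuous_intros dest: vanishing_continuous)

lemma vanishing_uniform_limit:
  assumes "\<And>n::nat. f n \<in> vanishing" "uniform_limit UNIV f g sequentially"
  shows "g \<in> vanishing"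
  unfolding vanishing_def
proof safe
  show "continuous_on UNIV g"
    by (rule uniform_limit_theorem[OF _ assms(2)])
      (auto intro!: always_eventually vanishing_continuous assms(1))
  fix e :: real assume "e > 0"
  then have e: "e / 2 > 0" by simp
  from uniform_limitD[OF assms(2) e] obtain n where n: "\<And>x. cmod (f n x - g x) < e / 2"
    by (auto simp: eventually_sequentially dist_norm)
  obtain K where K: "compact K" "\<And>x. x \<notin> K \<Longrightarrow> cmod (f n x) < e / 2"
    using assms(1)[of n] e unfolding vanishing_def by blast
  have "cmod (g x) < e" if "x \<notin> K" for x
    using n[of x] K(2)[OF that] norm_triangle_ineq4[of "f n x" "f n x - g x"] by simp
  then show "\<exists>K. compact K \<and> (\<forall>x. x \<notin> K \<longrightarrow> cmod (g x) < e)"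
    using K(1) by blast
qed

typedef (overloaded) 'a c0 = "vanishing :: ('a::topological_space \<Rightarrow> complex) set"
  morphisms apply_c0 Abs_c0
  using vanishing_zero by blast

setup_lifting type_definition_c0

lemma c0_eqI: "(\<And>x. apply_c0 f x = apply_c0 g x) \<Longrightarrow> f = g"
  by transfer auto

instantiation c0 :: (topological_space) comm_ring
begin

lift_definition zero_c0 :: "'a c0" is "\<lambda>_. 0" by (rule vanishing_zero)
lift_definition plus_c0 :: "'a c0 \<Rightarrow> 'a c0 \<Rightarrow> 'a c0" is "\<lambda>f g x. f x + g x"
  by (rule vanishing_add)
lift_definition uminus_c0 :: "'a c0 \<Rightarrow> 'a c0" is "\<lambda>f x. - f x" by (rule vanishing_minus)
lift_definition minus_c0 :: "'a c0 \<Rightarrow> 'a c0 \<Rightarrow> 'a c0" is "\<lambda>f g x. f x - g x"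
  by (rule vanishing_diff)
lift_definition times_c0 :: "'a c0 \<Rightarrow> 'a c0 \<Rightarrow> 'a c0" is "\<lambda>f g x. f x * g x"
  by (rule vanishing_mult)

instance by standard (transfer, auto simp: algebra_simps fun_eq_iff)+

end

instantiation c0 :: (topological_space) real_algebra
begin

lift_definition scaleR_c0 :: "real \<Rightarrow> 'a c0 \<Rightarrow> 'a c0" is "\<lambda>r f x. r *\<^sub>R f x"
  by (simp add: scaleR_conv_of_real vanishing_scale)

instance by standard (transfer, auto simp: algebra_simps fun_eq_iff)+

end

instantiation c0 :: (topological_space) real_normed_algebra
begin

lift_definition norm_c0 :: "'a c0 \<Rightarrow> real" is "\<lambda>f. SUP x. cmod (f x)" .

definition dist_c0 :: "'a c0 \<Rightarrow> 'a c0 \<Rightarrow> real" where "dist_c0 f g = norm (f - g)"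

definition sgn_c0 :: "'a c0 \<Rightarrow> 'a c0" where "sgn_c0 f = f /\<^sub>R norm f"

definition uniformity_c0 :: "('a c0 \<times> 'a c0) filter"
  where "uniformity_c0 = (INF e\<in>{0<..}. principal {(f, g). dist f g < e})"

definition open_c0 :: "'a c0 set \<Rightarrow> bool"
  where "open_c0 S = (\<forall>f\<in>S. \<forall>\<^sub>F (f', g) in uniformity. f' = f \<longrightarrow> g \<in> S)"

lemma norm_c0_upper: "cmod (apply_c0 f x) \<le> norm (f :: 'a c0)"
proof transfer
  fix f :: "'a \<Rightarrow> complex" and x assume "f \<in> vanishing"
  then have "bdd_above (range (\<lambda>x. cmod (f x)))"
    using vanishing_bounded[of f] by (auto simp: bdd_above_def)
  then show "cmod (f x) \<le> (SUP x. cmod (f x))"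
    by (intro cSUP_upper) auto
qed

lemma norm_c0_least: "(\<And>x. cmod (apply_c0 f x) \<le> B) \<Longrightarrow> norm (f :: 'a c0) \<le> B"
  by transfer (auto intro!: cSUP_least)

lemma norm_c0_nonneg: "0 \<le> norm (f :: 'a c0)"
  using norm_c0_upper[of f undefined] norm_ge_zero[of "apply_c0 f undefined"] by linarith

instance
proof
  fix f g :: "'a c0" and r :: real
  show "dist f g = norm (f - g)" by (rule dist_c0_def)
  show "sgn f = f /\<^sub>R norm f" by (rule sgn_c0_def)
  show "uniformity = (INF e\<in>{0<..}. principal {(f, g :: 'a c0). dist f g < e})"
    by (rule uniformity_c0_def)
  show "open S = (\<forall>f\<in>S. \<forall>\<^sub>F (f', g) in uniformity. f' = f \<longrightarrow> g \<in> S)" for S :: "'a c0 set"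
    by (rule open_c0_def)
  show "norm f = 0 \<longleftrightarrow> f = 0"
  proof
    assume "norm f = 0"
    then have "apply_c0 f x = 0" for x using norm_c0_upper[of f x] by simp
    then show "f = 0" by (intro c0_eqI) (simp add: zero_c0.rep_eq)
  next
    assume "f = 0"
    then have "norm f \<le> 0" by (intro norm_c0_least) (simp add: zero_c0.rep_eq)
    then show "norm f = 0" using norm_c0_nonneg[of f] by simp
  qed
  show "norm (f + g) \<le> norm f + norm g"
    by (rule norm_c0_least)
      (auto simp: plus_c0.rep_eq intro!: norm_triangle_le add_mono norm_c0_upper)
  have le: "norm (r *\<^sub>R f) \<le> \<bar>r\<bar> * norm f" for r and f :: "'a c0"
    by (rule norm_c0_least)
      (auto simp: scaleR_c0.rep_eq intro!: mult_left_mono norm_c0_upper)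
  show "norm (r *\<^sub>R f) = \<bar>r\<bar> * norm f"
  proof (cases "r = 0")
    case True
    then show ?thesis using le[of r f] norm_c0_nonneg[of "r *\<^sub>R f"] by simp
  next
    case False
    then have "norm f \<le> \<bar>inverse r\<bar> * norm (r *\<^sub>R f)"
      using le[of "inverse r" "r *\<^sub>R f"] by simp
    then have "\<bar>r\<bar> * norm f \<le> norm (r *\<^sub>R f)"
      using False by (simp add: field_simps)
    then show ?thesis using le[of r f] by simp
  qed
  show "norm (f * g) \<le> norm f * norm g"
    by (rule norm_c0_least)
      (auto simp: times_c0.rep_eq norm_mult intro!: mult_mono norm_c0_upper norm_c0_nonneg)
qed

end

instance c0 :: (topological_space) banach
proof
  fix f :: "nat \<Rightarrow> 'a c0" assume C: "Cauchy f"
  have "\<forall>e>0. \<exists>N. \<forall>m n x. N \<le> m \<and> N \<le> n \<and> True \<longrightarrow>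
          dist (apply_c0 (f m) x) (apply_c0 (f n) x) < e"
  proof (intro allI impI)
    fix e :: real assume "e > 0"
    then obtain N where N: "\<And>m n. N \<le> m \<Longrightarrow> N \<le> n \<Longrightarrow> norm (f m - f n) < e"
      using C unfolding Cauchy_def dist_norm by blast
    show "\<exists>N. \<forall>m n x. N \<le> m \<and> N \<le> n \<and> True \<longrightarrow>
          dist (apply_c0 (f m) x) (apply_c0 (f n) x) < e"
    proof (intro exI allI impI)
      fix m n x assume "N \<le> m \<and> N \<le> n \<and> True"
      then show "dist (apply_c0 (f m) x) (apply_c0 (f n) x) < e"
        using N[of m n] norm_c0_upper[of "f m - f n" x] by (simp add: dist_norm minus_c0.rep_eq)
    qed
  qed
  then obtain g where g: "\<forall>e>0. \<exists>N. \<forall>n x. N \<le> n \<and> True \<longrightarrow> dist (apply_c0 (f n) x) (g x) < e"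
    using uniformly_convergent_eq_cauchy[of "\<lambda>_. True" "\<lambda>n. apply_c0 (f n)"] by blast
  then have u: "uniform_limit UNIV (\<lambda>n. apply_c0 (f n)) g sequentially"
    by (auto simp: uniform_limit_sequentially_iff)
  then have "g \<in> vanishing"
    by (rule vanishing_uniform_limit[OF apply_c0])
  then have G: "apply_c0 (Abs_c0 g) = g" by (simp add: Abs_c0_inverse)
  have "f \<longlonglongrightarrow> Abs_c0 g"
  proof (rule LIMSEQ_I)
    fix r :: real assume "r > 0"
    then obtain N where N: "\<And>n x. N \<le> n \<Longrightarrow> dist (apply_c0 (f n) x) (g x) < r / 2"
      using g by (meson half_gt_zero)
    have "norm (f n - Abs_c0 g) < r" if "n \<ge> N" for n
    proof -
      have "norm (f n - Abs_c0 g) \<le> r / 2"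
        by (rule norm_c0_least)
          (use N[OF that] in \<open>auto simp: minus_c0.rep_eq G dist_norm intro: less_imp_le\<close>)
      then show ?thesis using \<open>r > 0\<close> by simp
    qed
    then show "\<exists>N. \<forall>n\<ge>N. norm (f n - Abs_c0 g) < r" by blast
  qed
  then show "convergent f" by (rule convergentI)
qed

instantiation c0 :: (topological_space) cstar_algebra
begin

lift_definition scaleC_c0 :: "complex \<Rightarrow> 'a c0 \<Rightarrow> 'a c0" is "\<lambda>c f x. c * f x"
  by (rule vanishing_scale)

lift_definition star_c0 :: "'a c0 \<Rightarrow> 'a c0" is "\<lambda>f x. cnj (f x)"
  by (rule vanishing_cnj)

instance
proof
  fix a b :: "'a c0" and c d :: complex and r :: real
  show "c *\<^sub>C (a + b) = c *\<^sub>C a + c *\<^sub>C b" by transfer (simp add: algebra_simps)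
  show "(c + d) *\<^sub>C a = c *\<^sub>C a + d *\<^sub>C a" by transfer (simp add: algebra_simps)
  show "c *\<^sub>C d *\<^sub>C a = (c * d) *\<^sub>C a" by transfer (simp add: algebra_simps)
  show "complex_of_real r *\<^sub>C a = r *\<^sub>R a" by transfer (simp add: scaleR_conv_of_real)
  show "(c *\<^sub>C a) * b = c *\<^sub>C (a * b)" by transfer (simp add: algebra_simps)
  show "a * (c *\<^sub>C b) = c *\<^sub>C (a * b)" by transfer (simp add: algebra_simps)
  show "star (a + b) = star a + star b" by transfer simp
  show "star (c *\<^sub>C a) = cnj c *\<^sub>C star a" by transfer simp
  show "star (a * b) = star b * star a" by transfer (simp add: mult.commute)
  show "star (star a) = a" by transfer simp
  have le: "norm (c *\<^sub>C a) \<le> cmod c * norm a" for c and a :: "'a c0"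
    by (rule norm_c0_least)
      (auto simp: scaleC_c0.rep_eq norm_mult intro!: mult_left_mono norm_c0_upper)
  show "norm (c *\<^sub>C a) = cmod c * norm a"
  proof (cases "c = 0")
    case True
    then show ?thesis using le[of c a] norm_ge_zero[of "c *\<^sub>C a"] by simp
  next
    case False
    then have "inverse c *\<^sub>C c *\<^sub>C a = a" by transfer (simp add: field_simps)
    then have "norm a \<le> cmod (inverse c) * norm (c *\<^sub>C a)"
      using le[of "inverse c" "c *\<^sub>C a"] by simp
    then have "cmod c * norm a \<le> norm (c *\<^sub>C a)"
      using False by (simp add: norm_inverse norm_divide field_simps)
    then show ?thesis using le[of c a] by simp
  qed
  show "norm (star a * a) = (norm a)\<^sup>2"
  proof (rule antisym)
    show "norm (star a * a) \<le> (norm a)\<^sup>2"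
      by (rule norm_c0_least) (auto simp: times_c0.rep_eq star_c0.rep_eq norm_mult power2_eq_square
          intro!: mult_mono norm_c0_upper)
    have "cmod (apply_c0 a x) \<le> sqrt (norm (star a * a))" for x
      using norm_c0_upper[of "star a * a" x]
      by (intro real_le_rsqrt) (simp add: times_c0.rep_eq star_c0.rep_eq norm_mult power2_eq_square)
    then have "norm a \<le> sqrt (norm (star a * a))" by (rule norm_c0_least)
    then have "(norm a)\<^sup>2 \<le> (sqrt (norm (star a * a)))\<^sup>2" by (intro power_mono) auto
    then show "(norm a)\<^sup>2 \<le> norm (star a * a)" by simp
  qed
qed

end

section \<open>Evaluations and the grading induced by an involution\<close>

lift_definition evaluation :: "'a::topological_space \<Rightarrow> 'a c0 \<Rightarrow>\<^sub>L complex" ("\<delta>")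
  is "\<lambda>x f. apply_c0 f x"
  by (rule bounded_linear_intro[of _ 1])
    (auto simp: plus_c0.rep_eq scaleR_c0.rep_eq norm_c0_upper)

text \<open>The following is meaningful only if \<open>f \<circ> \<theta>\<close> vanishes at infinity, as for homeomorphisms.\<close>

definition pullback :: "('a::topological_space \<Rightarrow> 'a) \<Rightarrow> 'a c0 \<Rightarrow> 'a c0" where
  "pullback \<theta> f = Abs_c0 (apply_c0 f \<circ> \<theta>)"

lemma apply_pullback:
  assumes "homeomorphism UNIV UNIV \<theta> (inv \<theta>)"
  shows "apply_c0 (pullback \<theta> f) = apply_c0 f \<circ> \<theta>"
proof -
  have f: "apply_c0 f \<in> vanishing" by (rule apply_c0)
  have "apply_c0 f \<circ> \<theta> \<in> vanishing"
    unfolding vanishing_def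
  proof safe
    show "continuous_on UNIV (apply_c0 f \<circ> \<theta>)"
      using assms f by (intro continuous_on_compose)
        (auto simp: homeomorphism_def dest: vanishing_continuous intro: continuous_on_subset)
    fix e :: real assume "e > 0"
    then obtain K where K: "compact K" "\<And>x. x \<notin> K \<Longrightarrow> cmod (apply_c0 f x) < e"
      using f unfolding vanishing_def by blast
    have "compact (inv \<theta> ` K)"
      using assms K(1) by (intro compact_continuous_image)
        (auto simp: homeomorphism_def intro: continuous_on_subset)
    moreover have "cmod ((apply_c0 f \<circ> \<theta>) x) < e" if "x \<notin> inv \<theta> ` K" for x
    proof -
      have "inv \<theta> (\<theta> x) = x" using assms by (simp add: homeomorphism_def)
      then have "\<theta> x \<notin> K" using that by (metis imageI)
      then show ?thesis using K(2) by simp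
    qed
    ultimately show "\<exists>K. compact K \<and> (\<forall>x. x \<notin> K \<longrightarrow> cmod ((apply_c0 f \<circ> \<theta>) x) < e)"
      by blast
  qed
  then show ?thesis by (simp add: pullback_def Abs_c0_inverse)
qed

lemma Z2_grading_pullback:
  assumes "homeomorphism UNIV UNIV \<theta> (inv \<theta>)" "\<theta> \<circ> \<theta> = id"
  shows "Z2_grading (pullback \<theta>)"
proof -
  note [simp] = apply_pullback[OF assms(1)]
  have "pullback \<theta> (pullback \<theta> f) = f" for f
    using assms(2) by (intro c0_eqI) (simp add: pointfree_idE)
  then have "pullback \<theta> \<circ> pullback \<theta> = id" by (simp add: fun_eq_iff)
  moreover from this have "bij (pullback \<theta>)" by (rule o_bij) fact
  ultimately show ?thesis
    by (auto simp: Z2_grading_def star_automorphism_def plus_c0.rep_eq scaleC_c0.rep_eq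
        times_c0.rep_eq star_c0.rep_eq intro!: c0_eqI)
qed

end

theory Submission
  imports Defs
begin

text \<open>
  The argument avoids the Riesz representation theorem. If \<open>\<phi>\<close> is an extreme even state and
  \<open>g\<close> is even with \<open>0 \<le> g \<le> 1\<close>, then \<open>\<phi> = \<phi>(g \<cdot>) + \<phi>((1 - g) \<cdot>)\<close> splits \<open>\<phi>\<close> into positive
  even functionals whose norms add up to one, so \<open>\<phi>(g f) = c \<phi>(f)\<close> for all \<open>f\<close>. At a point
  \<open>x\<close> of the support of \<open>\<phi>\<close> this forces \<open>c = g(x)\<close>, hence \<open>\<phi>\<close> is proportional to evaluation at
  \<open>x\<close> on even functions. Conversely, an even state dominated by a multiple of
  \<open>(\<delta>\<^sub>x + \<delta>\<^bsub>\<theta>(x)\<^esub>)/2\<close> annihilates every function vanishing at \<open>x\<close> and \<open>\<theta>(x)\<close>, and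
  evenness then determines it completely.
\<close>

section \<open>Functional calculus and bump functions\<close>

lemmas apply_c0_simps [simp] =
  zero_c0.rep_eq plus_c0.rep_eq minus_c0.rep_eq uminus_c0.rep_eq times_c0.rep_eq
  scaleR_c0.rep_eq scaleC_c0.rep_eq star_c0.rep_eq

text \<open>Intended for continuous \<open>G\<close> with \<open>G 0 = 0\<close>, where composition
  with \<open>G\<close> preserves vanishing at infinity and \<open>Abs_c0\<close> is applied inside
  its domain.\<close>

definition c0_map :: "(complex \<Rightarrow> complex) \<Rightarrow> 'a::topological_space c0 \<Rightarrow> 'a c0" where
  "c0_map G f = Abs_c0 (\<lambda>x. G (apply_c0 f x))"

text \<open>Continuity of \<open>G\<close> at 0 together with \<open>G 0 = 0\<close> makes the
  composite small wherever \<open>f\<close> is small, so the compact set that works for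
  \<open>f\<close> serves again.\<close>

lemma apply_c0_map:
  assumes "continuous_on UNIV G" "G 0 = 0"
  shows "apply_c0 (c0_map G f) x = G (apply_c0 f x)"
proof -
  have f: "apply_c0 f \<in> vanishing" by (rule apply_c0)
  have "(\<lambda>x. G (apply_c0 f x)) \<in> vanishing"
    unfolding vanishing_def
  proof safe
    show "continuous_on UNIV (\<lambda>x. G (apply_c0 f x))"
      by (rule continuous_on_compose2[OF assms(1) vanishing_continuous[OF f]]) auto
    fix e :: real assume "e > 0"
    then obtain d where d: "d > 0" "\<And>z. cmod z < d \<Longrightarrow> cmod (G z) < e"
      using assms unfolding continuous_on_iff by (metis UNIV_I dist_0_norm dist_commute)
    obtain K where K: "compact K" "\<And>x. x \<notin> K \<Longrightarrow> cmod (apply_c0 f x) < d"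
      using f d(1) unfolding vanishing_def by blast
    show "\<exists>K. compact K \<and> (\<forall>x. x \<notin> K \<longrightarrow> cmod (G (apply_c0 f x)) < e)"
      using K d(2) by blast
  qed
  then show ?thesis by (simp add: c0_map_def Abs_c0_inverse)
qed

definition cabs :: "'a::topological_space c0 \<Rightarrow> 'a c0" where
  "cabs = c0_map (\<lambda>z. of_real (cmod z))"

definition re_c0 :: "'a::topological_space c0 \<Rightarrow> 'a c0" where
  "re_c0 = c0_map (\<lambda>z. of_real (Re z))"

definition im_c0 :: "'a::topological_space c0 \<Rightarrow> 'a c0" where
  "im_c0 = c0_map (\<lambda>z. of_real (Im z))"

lemma apply_cabs [simp]: "apply_c0 (cabs f) x = of_real (cmod (apply_c0 f x))"
  unfolding cabs_def by (rule apply_c0_map) (auto intro!: continuous_intros)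

lemma apply_re_c0 [simp]: "apply_c0 (re_c0 f) x = of_real (Re (apply_c0 f x))"
  unfolding re_c0_def by (rule apply_c0_map) (auto intro!: continuous_intros)

lemma apply_im_c0 [simp]: "apply_c0 (im_c0 f) x = of_real (Im (apply_c0 f x))"
  unfolding im_c0_def by (rule apply_c0_map) (auto intro!: continuous_intros)

lemma norm_cabs: "norm (cabs f) \<le> norm f"
  by (rule norm_c0_least) (simp add: norm_c0_upper)

lemma re_im_c0: "f = re_c0 f + \<i> *\<^sub>C im_c0 f"
  by (rule c0_eqI) (simp add: complex_eq_iff)

section \<open>Pointwise nonnegative functions\<close>

definition nonneg_c0 :: "'a::topological_space c0 \<Rightarrow> bool" where
  "nonneg_c0 f \<longleftrightarrow> (\<forall>x. apply_c0 f x \<in> \<real>\<^sub>\<ge>\<^sub>0)"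

lemma nonneg_c0D: "nonneg_c0 f \<Longrightarrow> apply_c0 f x \<in> \<real>\<^sub>\<ge>\<^sub>0"
  by (simp add: nonneg_c0_def)

lemma nonneg_c0_cabs [simp]: "nonneg_c0 (cabs f)"
  by (simp add: nonneg_c0_def)

lemma nonneg_c0_add: "nonneg_c0 f \<Longrightarrow> nonneg_c0 g \<Longrightarrow> nonneg_c0 (f + g)"
  by (simp add: nonneg_c0_def complex_nonneg_Reals_iff)

lemma nonneg_c0_mult: "nonneg_c0 f \<Longrightarrow> nonneg_c0 g \<Longrightarrow> nonneg_c0 (f * g)"
  by (simp add: nonneg_c0_def complex_nonneg_Reals_iff)

lemma nonneg_c0_scaleR: "r \<ge> 0 \<Longrightarrow> nonneg_c0 f \<Longrightarrow> nonneg_c0 (r *\<^sub>R f)"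
  by (simp add: nonneg_c0_def complex_nonneg_Reals_iff)

lemma nonneg_c0_sum: "(\<And>i. i \<in> I \<Longrightarrow> nonneg_c0 (f i)) \<Longrightarrow> nonneg_c0 (sum f I)"
  by (induction I rule: infinite_finite_induct) (auto intro: nonneg_c0_add simp: nonneg_c0_def)

lemma nonneg_c0_star_mult: "nonneg_c0 (star f * f)"
  by (simp add: nonneg_c0_def complex_nonneg_Reals_iff)

lemma Re_apply_c0_le_norm: "Re (apply_c0 f x) \<le> norm f"
  using complex_Re_le_cmod norm_c0_upper order_trans by blast

lemma apply_c0_sum: "apply_c0 (sum f I) x = (\<Sum>i\<in>I. apply_c0 (f i) x)"
  by (induction I rule: infinite_finite_induct) auto

text \<open>The combination equals 1 - (1 - f) (1 - g), a common upper bound of \<open>f\<close> and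
  \<open>g\<close> that stays in the unit ball. It needs no unit and treats \<open>f\<close> and
  \<open>g\<close> symmetrically.\<close>

lemma nonneg_c0_join:
  assumes f: "nonneg_c0 f" "norm f \<le> 1" and g: "nonneg_c0 g" "norm g \<le> 1"
  shows "norm (f + g - f * g) \<le> 1"
    and "nonneg_c0 (f + g - f * g - f)" and "nonneg_c0 (f + g - f * g - g)"
proof -
  define F where "F = f + g - f * g"
  have *: "\<exists>r s. apply_c0 f x = of_real r \<and> apply_c0 g x = of_real s \<and>
      0 \<le> r \<and> r \<le> 1 \<and> 0 \<le> s \<and> s \<le> 1" for x
  proof -
    obtain r s where rs: "apply_c0 f x = of_real r" "r \<ge> 0" "apply_c0 g x = of_real s" "s \<ge> 0"
      using nonneg_c0D f(1) g(1) by (metis nonneg_Reals_cases)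
    then have "r \<le> 1" "s \<le> 1"
      using Re_apply_c0_le_norm[of f x] Re_apply_c0_le_norm[of g x] f(2) g(2) by auto
    then show ?thesis using rs by auto
  qed
  have "nonneg_c0 (F - f)" "nonneg_c0 (F - g)"
    unfolding nonneg_c0_def
  proof safe
    fix x
    obtain r s where rs: "apply_c0 f x = of_real r" "apply_c0 g x = of_real s"
        "0 \<le> r" "r \<le> 1" "0 \<le> s" "s \<le> 1"
      using * by blast
    have "apply_c0 (F - f) x = of_real (s * (1 - r))" "apply_c0 (F - g) x = of_real (r * (1 - s))"
      by (auto simp: F_def rs algebra_simps)
    then show "apply_c0 (F - f) x \<in> \<real>\<^sub>\<ge>\<^sub>0" "apply_c0 (F - g) x \<in> \<real>\<^sub>\<ge>\<^sub>0"
      using rs by (simp_all only: nonneg_Reals_of_real_iff) auto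
  qed
  moreover have "norm F \<le> 1"
  proof (rule norm_c0_least)
    fix x
    obtain r s where rs: "apply_c0 f x = of_real r" "apply_c0 g x = of_real s"
        "0 \<le> r" "r \<le> 1" "0 \<le> s" "s \<le> 1"
      using * by blast
    have "0 \<le> (1 - r) * (1 - s)" "(1 - r) * (1 - s) \<le> 1"
      using rs by (auto intro!: mult_le_one)
    moreover have "apply_c0 F x = of_real (1 - (1 - r) * (1 - s))"
      by (simp add: F_def rs algebra_simps)
    ultimately show "cmod (apply_c0 F x) \<le> 1"
      by (simp only: norm_of_real)
  qed
  ultimately show "norm (f + g - f * g) \<le> 1"
    "nonneg_c0 (f + g - f * g - f)" "nonneg_c0 (f + g - f * g - g)"
    by (simp_all add: F_def)
qed

text \<open>Locally compact Hausdorff spaces are completely regular, so \<open>x\<close> can be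
  separated from the complement of an open neighbourhood \<open>U\<close> lying in a compact set.
  One minus the separating function is zero outside that compact set.\<close>

lemma exists_bump:
  fixes x :: "'a::t2_space"
  assumes "locally compact (UNIV :: 'a set)"
  obtains h where "nonneg_c0 h" "norm h \<le> 1" "apply_c0 h x = 1"
proof -
  obtain U K where UK: "open U" "compact K" "x \<in> U" "U \<subseteq> K"
    using assms unfolding locally_def by (metis UNIV_I open_UNIV open_openin subtopology_UNIV)
  have "locally_compact_space (euclidean :: 'a topology)"
    unfolding locally_compact_space_def
  proof
    fix y :: 'a
    show "\<exists>U K. openin euclidean U \<and> compactin euclidean K \<and> y \<in> U \<and> U \<subseteq> K"
      using assms unfolding locally_def
      by (metis UNIV_I open_UNIV open_openin subtopology_UNIV compactin_euclidean_iff)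
  qed
  moreover have "Hausdorff_space (euclidean :: 'a topology)"
    unfolding Hausdorff_space_def by (metis disjnt_def hausdorff open_openin)
  ultimately have reg: "completely_regular_space (euclidean :: 'a topology)"
    using locally_compact_Hausdorff_imp_regular_space
      locally_compact_regular_imp_completely_regular_space by blast
  have "closedin euclidean (- U) \<and> x \<in> topspace euclidean - (- U)"
    using UK(1,3) by auto
  then obtain f :: "'a \<Rightarrow> real" where
      "continuous_map euclidean (top_of_set {0..1}) f" "f x = 0" "f ` (- U) \<subseteq> {1}"
    using reg unfolding completely_regular_space_def by metis
  then have f: "continuous_on UNIV f" "\<And>y. f y \<in> {0..1}" "f x = 0" "\<And>y. y \<notin> U \<Longrightarrow> f y = 1"
    by (auto simp: image_subset_iff continuous_map_in_subtopology)
  define h where "h = Abs_c0 (\<lambda>y. complex_of_real (1 - f y))"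
  have "(\<lambda>y. complex_of_real (1 - f y)) \<in> vanishing"
    unfolding vanishing_def
  proof safe
    show "continuous_on UNIV (\<lambda>y. complex_of_real (1 - f y))"
      by (intro continuous_intros f(1))
    show "\<exists>K. compact K \<and> (\<forall>y. y \<notin> K \<longrightarrow> cmod (complex_of_real (1 - f y)) < e)"
      if "e > 0" for e :: real
    proof (intro exI conjI allI impI)
      fix y assume "y \<notin> K"
      then have "f y = 1" using UK(4) f(4) by blast
      then show "cmod (complex_of_real (1 - f y)) < e" using that by simp
    qed (rule UK(2))
  qed
  then have h: "apply_c0 h y = complex_of_real (1 - f y)" for y
    by (simp add: h_def Abs_c0_inverse)
  show ?thesis
  proof
    show "nonneg_c0 h"
      using f(2) by (auto simp: nonneg_c0_def h complex_nonneg_Reals_iff)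
    show "norm h \<le> 1"
      by (rule norm_c0_least) (use f(2) in \<open>simp add: h del: of_real_diff\<close>)
    show "apply_c0 h x = 1" by (simp add: h f(3))
  qed
qed

section \<open>Positive functionals\<close>

text \<open>A state without its normalisation, so that the summands into which a state is split are
  covered as well.\<close>

definition positive_functional :: "('a::cstar_algebra \<Rightarrow>\<^sub>L complex) \<Rightarrow> bool" where
  "positive_functional \<psi> \<longleftrightarrow>
     (\<forall>c a. blinfun_apply \<psi> (c *\<^sub>C a) = c * blinfun_apply \<psi> a) \<and>
     (\<forall>a. blinfun_apply \<psi> (star a * a) \<in> \<real>\<^sub>\<ge>\<^sub>0)"

lemma state_iff: "state \<phi> \<longleftrightarrow> positive_functional \<phi> \<and> norm \<phi> = 1"
  by (auto simp: state_def positive_functional_def)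

lemma positive_scaleC: "positive_functional \<psi> \<Longrightarrow> \<psi> (c *\<^sub>C a) = c * blinfun_apply \<psi> a"
  by (simp add: positive_functional_def)

lemma positive_functional_scaleR:
  "r \<ge> 0 \<Longrightarrow> positive_functional P \<Longrightarrow> positive_functional (r *\<^sub>R P)"
  by (simp add: positive_functional_def blinfun.scaleR_left complex_nonneg_Reals_iff)

text \<open>A nonnegative function is \<open>star s * s\<close> for its pointwise square root
  \<open>s\<close>.\<close>

lemma positive_nonneg:
  assumes "positive_functional \<psi>" "nonneg_c0 f"
  shows "blinfun_apply \<psi> f \<in> \<real>\<^sub>\<ge>\<^sub>0"
proof -
  define s where "s = c0_map (\<lambda>z. of_real (sqrt (cmod z))) f"
  have s: "apply_c0 s x = of_real (sqrt (cmod (apply_c0 f x)))" for x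
    unfolding s_def by (rule apply_c0_map) (auto intro!: continuous_intros)
  have "f = star s * s"
  proof (rule c0_eqI)
    fix x
    obtain r where "apply_c0 f x = of_real r" "r \<ge> 0"
      using nonneg_c0D[OF assms(2)] by (metis nonneg_Reals_cases)
    then show "apply_c0 f x = apply_c0 (star s * s) x"
      by (simp add: s flip: of_real_mult)
  qed
  then show ?thesis using assms(1) by (simp add: positive_functional_def)
qed

lemma positive_mono:
  assumes "positive_functional \<psi>" "nonneg_c0 (g - f)"
  shows "Re (blinfun_apply \<psi> f) \<le> Re (blinfun_apply \<psi> g)"
  using positive_nonneg[OF assms] by (simp add: blinfun.diff_right complex_nonneg_Reals_iff)

text \<open>Writes a real function as a difference of two nonnegative ones, \<open>cabs f\<close>
  and \<open>cabs f - f\<close>.\<close>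

lemma real_eq_diff_nonneg:
  assumes "\<And>x. apply_c0 f x \<in> \<real>"
  shows "nonneg_c0 (cabs f - f)"
  using assms by (auto simp: nonneg_c0_def complex_nonneg_Reals_iff complex_is_Real_iff
      complex_Re_le_cmod)

lemma positive_real:
  assumes "positive_functional \<psi>" "\<And>x. apply_c0 f x \<in> \<real>"
  shows "Im (blinfun_apply \<psi> f) = 0"
  using positive_nonneg[OF assms(1) nonneg_c0_cabs[of f]]
    positive_nonneg[OF assms(1) real_eq_diff_nonneg[OF assms(2)]]
  by (simp add: blinfun.diff_right complex_nonneg_Reals_iff)

text \<open>Rotating \<open>f\<close> by a phase makes the value of the functional real and
  nonnegative. Only the real part of the rotated function then contributes, and it is bounded by
  \<open>cabs f\<close>.\<close>

lemma positive_norm_le_cabs: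
  assumes "positive_functional \<psi>"
  shows "cmod (blinfun_apply \<psi> f) \<le> Re (blinfun_apply \<psi> (cabs f))"
proof -
  define w where "w = blinfun_apply \<psi> f"
  \<comment> \<open>The phase that turns \<open>w\<close> into \<open>cmod w\<close>; the value 1 at
    \<open>w = 0\<close> keeps \<open>cmod c = 1\<close>.\<close>
  define c where "c = (if w = 0 then 1 else cnj w / cmod w)"
  have c: "cmod c = 1" "c * w = cmod w"
    by (auto simp: c_def norm_divide complex_norm_square[symmetric] power2_eq_square
        mult.commute[of "cnj w"])
  define u where "u = c *\<^sub>C f"
  have "\<psi> u = cmod w" using assms by (simp add: u_def positive_scaleC c flip: w_def)
  moreover have "\<psi> u = \<psi> (re_c0 u) + \<i> * \<psi> (im_c0 u)"
    by (subst re_im_c0) (simp add: blinfun.add_right positive_scaleC[OF assms])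
  moreover have "Im (\<psi> (im_c0 u)) = 0" by (rule positive_real[OF assms]) simp
  ultimately have "cmod w = Re (\<psi> (re_c0 u))"
    by (metis Re_complex_of_real add.right_neutral plus_complex.simps(1) Re_i_times minus_zero)
  also have "\<dots> \<le> Re (\<psi> (cabs f))"
  proof (rule positive_mono[OF assms])
    have "Re (apply_c0 u x) \<le> cmod (apply_c0 f x)" for x
      using complex_Re_le_cmod[of "apply_c0 u x"] by (simp add: u_def norm_mult c)
    then show "nonneg_c0 (cabs f - re_c0 u)"
      by (simp add: nonneg_c0_def complex_nonneg_Reals_iff)
  qed
  finally show ?thesis by (simp add: w_def)
qed

lemma positive_eqI:
  assumes "positive_functional P" "positive_functional Q"
    and "\<And>f. nonneg_c0 f \<Longrightarrow> blinfun_apply P f = blinfun_apply Q f"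
  shows "P = Q"
proof (rule blinfun_eqI)
  fix f
  have real: "blinfun_apply P g = blinfun_apply Q g" if "\<And>x. apply_c0 g x \<in> \<real>" for g
    using assms(3)[OF nonneg_c0_cabs[of g]] assms(3)[OF real_eq_diff_nonneg[OF that]]
    by (simp add: blinfun.diff_right)
  have "P (re_c0 f + \<i> *\<^sub>C im_c0 f) = Q (re_c0 f + \<i> *\<^sub>C im_c0 f)"
    using assms by (simp add: blinfun.add_right positive_scaleC real)
  then show "P f = Q f" by (simp flip: re_im_c0)
qed

text \<open>By \<open>positive_norm_le_cabs\<close> it suffices to test on \<open>cabs f\<close>,
  rescaled into the unit ball.\<close>

lemma positive_norm_bound:
  assumes "positive_functional P" "0 \<le> b"
    and "\<And>f. nonneg_c0 f \<Longrightarrow> norm f \<le> 1 \<Longrightarrow> Re (blinfun_apply P f) \<le> b"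
  shows "norm P \<le> b"
proof (rule norm_blinfun_bound[OF assms(2)])
  fix f
  show "cmod (blinfun_apply P f) \<le> b * norm f"
  proof (cases "f = 0")
    case False
    define g where "g = inverse (norm f) *\<^sub>R cabs f"
    have "norm g \<le> 1" using norm_cabs[of f] False by (simp add: g_def field_simps)
    then have "Re (P g) \<le> b"
      by (intro assms(3)) (auto simp: g_def intro!: nonneg_c0_scaleR)
    then have "Re (P (cabs f)) \<le> b * norm f"
      using False by (simp add: g_def blinfun.scaleR_right field_simps)
    then show ?thesis using positive_norm_le_cabs[OF assms(1), of f] by linarith
  qed (simp add: blinfun.zero_right)
qed

text \<open>
  Near-maximisers \<open>f\<close> and \<open>g\<close> for the two functionals are both dominated by
  \<open>f + g - f g = 1 - (1 - f) (1 - g)\<close>, which again has norm at most one.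
\<close>

lemma positive_norm_add:
  fixes P Q :: "'a::topological_space c0 \<Rightarrow>\<^sub>L complex"
  assumes P: "positive_functional P" and Q: "positive_functional Q"
  shows "norm (P + Q) = norm P + norm Q"
proof (rule antisym[OF norm_triangle_ineq])
  have key: "Re (P f) + Re (Q g) \<le> norm (P + Q)"
    if f: "nonneg_c0 f" "norm f \<le> 1" and g: "nonneg_c0 g" "norm g \<le> 1" for f g
  proof -
    define F where "F = f + g - f * g"
    have "Re (P f) \<le> Re (P F)" "Re (Q g) \<le> Re (Q F)"
      unfolding F_def using positive_mono P Q nonneg_c0_join[OF f g] by blast+
    moreover have "norm F \<le> 1"
      unfolding F_def by (rule nonneg_c0_join[OF f g])
    then have "Re ((P + Q) F) \<le> norm (P + Q)"
      by (smt (verit) complex_Re_le_cmod mult_left_le norm_blinfun norm_ge_zero)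
    ultimately show ?thesis by (simp add: blinfun.add_left)
  qed
  \<comment> \<open>Testing with the zero function supplies the nonnegativity of the bounds that
    \<open>positive_norm_bound\<close> asks for. The suprema are then taken one after the other,
    first over \<open>f\<close> and then over \<open>g\<close>.\<close>
  have z: "nonneg_c0 (0 :: 'a c0)" "norm (0 :: 'a c0) \<le> 1"
    by (auto simp: nonneg_c0_def)
  have 1: "norm P \<le> norm (P + Q) - Re (Q g)" if "nonneg_c0 g" "norm g \<le> 1" for g
    using key that key[OF z that]
    by (intro positive_norm_bound[OF P]) (auto simp: algebra_simps blinfun.zero_right)
  have "norm Q \<le> norm (P + Q) - norm P"
    using 1 1[OF z]
    by (intro positive_norm_bound[OF Q]) (auto simp: algebra_simps blinfun.zero_right)
  then show "norm P + norm Q \<le> norm (P + Q)" by simp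
qed

text \<open>A support point is found by compactness: otherwise every function is dominated, up to a small
  uniform error, by a finite sum of functions annihilated by \<open>\<psi>\<close>.\<close>

lemma positive_support_point:
  fixes \<psi> :: "'a::topological_space c0 \<Rightarrow>\<^sub>L complex"
  assumes \<psi>: "positive_functional \<psi>" "\<psi> \<noteq> 0"
  obtains x where "\<And>g. nonneg_c0 g \<Longrightarrow> \<psi> g = 0 \<Longrightarrow> apply_c0 g x = 0"
proof (rule ccontr)
  assume "\<not> thesis"
  then have ex: "\<exists>g. nonneg_c0 g \<and> \<psi> g = 0 \<and> apply_c0 g x \<noteq> 0" for x
    using that by blast
  have "\<psi> f = 0" if f: "nonneg_c0 f" for f
  proof -
    have "\<exists>g. nonneg_c0 g \<and> \<psi> g = 0 \<and> Re (apply_c0 g x) > Re (apply_c0 f x)" for x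
    proof -
      obtain g where g: "nonneg_c0 g" "\<psi> g = 0" "apply_c0 g x \<noteq> 0" using ex by blast
      then have "Re (apply_c0 g x) > 0"
        using nonneg_c0D[OF g(1), of x] by (auto simp: complex_nonneg_Reals_iff complex_eq_iff)
      \<comment> \<open>Scales \<open>g\<close> so that its value at \<open>x\<close> exceeds that
        of \<open>f\<close> by exactly 1.\<close>
      moreover define r where "r = (Re (apply_c0 f x) + 1) / Re (apply_c0 g x)"
      moreover have "Re (apply_c0 f x) \<ge> 0"
        using nonneg_c0D[OF f, of x] by (auto simp: complex_nonneg_Reals_iff)
      ultimately have "r \<ge> 0" "Re (apply_c0 (r *\<^sub>R g) x) > Re (apply_c0 f x)" by auto
      then show ?thesis using g(1,2)
        by (intro exI[of _ "r *\<^sub>R g"]) (auto intro: nonneg_c0_scaleR simp: blinfun.scaleR_right)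
    qed
    then obtain g where g: "\<And>x. nonneg_c0 (g x)" "\<And>x. \<psi> (g x) = 0"
        "\<And>x. Re (apply_c0 (g x) x) > Re (apply_c0 f x)"
      by metis
    have cont: "continuous_on UNIV (\<lambda>y. Re (apply_c0 h y))" for h :: "'a c0"
      by (intro continuous_intros vanishing_continuous apply_c0)
    have "cmod (\<psi> f) \<le> e" if "e > 0" for e
    proof -
      have "e / norm \<psi> > 0" using that \<psi>(2) by simp
      \<comment> \<open>A uniform error of \<open>d\<close> changes the value of
        \<open>\<psi>\<close> by at most \<open>norm \<psi> * d = e\<close>.\<close>
      moreover define d where "d = e / norm \<psi>"
      ultimately have d: "d > 0" by simp
      obtain K where K: "compact K" "\<And>x. x \<notin> K \<Longrightarrow> cmod (apply_c0 f x) < d"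
        using apply_c0[of f] d unfolding vanishing_def by blast
      define V where "V x = {y. Re (apply_c0 f y) < Re (apply_c0 (g x) y)}" for x
      have "open (V x)" for x unfolding V_def by (rule open_Collect_less[OF cont cont])
      moreover have "K \<subseteq> (\<Union>x\<in>UNIV. V x)" using g(3) by (auto simp: V_def)
      ultimately obtain D where D: "finite D" "K \<subseteq> (\<Union>x\<in>D. V x)"
        using compactE_image[OF K(1), of UNIV V] by metis
      define G where "G = sum g D"
      have G: "nonneg_c0 G" "\<psi> G = 0"
        unfolding G_def using g by (auto intro: nonneg_c0_sum simp: blinfun.sum_right)
      \<comment> \<open>The truncation (f - d)^+ is uniformly within \<open>d\<close> of
        \<open>f\<close> and vanishes off \<open>K\<close>. Hence the finite sum \<open>G\<close>,
        which exceeds \<open>f\<close> on \<open>K\<close>, dominates \<open>p\<close> everywhere,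
        and \<open>\<psi> p = 0\<close>.\<close>
      define p where "p = c0_map (\<lambda>z. of_real (max (Re z - d) 0)) f"
      have p: "apply_c0 p y = of_real (max (Re (apply_c0 f y) - d) 0)" for y
        unfolding p_def by (rule apply_c0_map) (use d in \<open>auto intro!: continuous_intros\<close>)
      have pG: "nonneg_c0 (G - p)"
        unfolding nonneg_c0_def
      proof
        fix y
        have G0: "Re (apply_c0 G y) \<ge> 0" "Im (apply_c0 G y) = 0"
          using nonneg_c0D[OF G(1), of y] by (auto simp: complex_nonneg_Reals_iff)
        have "max (Re (apply_c0 f y) - d) 0 \<le> Re (apply_c0 G y)"
        proof (cases "y \<in> K")
          case True
          then obtain x where x: "x \<in> D" "Re (apply_c0 f y) < Re (apply_c0 (g x) y)"
            using D(2) by (auto simp: V_def)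
          have "Re (apply_c0 (g x) y) \<le> (\<Sum>x\<in>D. Re (apply_c0 (g x) y))"
            using g(1) x(1) D(1) by (intro member_le_sum) (auto simp: nonneg_c0_def complex_nonneg_Reals_iff)
          then show ?thesis using x(2) d G0 by (simp add: G_def apply_c0_sum)
        next
          case False
          then show ?thesis
            using K(2)[of y] complex_Re_le_cmod[of "apply_c0 f y"] G0 by simp
        qed
        then show "apply_c0 (G - p) y \<in> \<real>\<^sub>\<ge>\<^sub>0"
          using G0 by (simp add: p complex_nonneg_Reals_iff)
      qed
      have p0: "nonneg_c0 p" by (simp add: nonneg_c0_def p complex_nonneg_Reals_iff)
      have "\<psi> p = 0"
        using positive_mono[OF \<psi>(1) pG] G(2) positive_nonneg[OF \<psi>(1) p0]
        by (simp add: complex_nonneg_Reals_iff complex_eq_iff)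
      then have "\<psi> f = \<psi> (f - p)" by (simp add: blinfun.diff_right)
      also have "cmod \<dots> \<le> norm \<psi> * norm (f - p)" by (rule norm_blinfun)
      also have "norm (f - p) \<le> d"
      proof (rule norm_c0_least)
        fix y
        obtain r where "apply_c0 f y = of_real r" "r \<ge> 0"
          using nonneg_c0D[OF f] by (metis nonneg_Reals_cases)
        then show "cmod (apply_c0 (f - p) y) \<le> d"
          using d by (simp add: p max_def flip: of_real_diff)
      qed
      finally show ?thesis using \<psi>(2) by (simp add: d_def)
    qed
    then show ?thesis by (metis dense norm_le_zero_iff not_le order.strict_trans1 less_irrefl)
  qed
  then have "\<psi> = 0"
    by (intro positive_eqI \<psi>(1)) (auto simp: positive_functional_def)
  then show False using \<psi>(2) by simp
qed

section \<open>Even states for an involution\<close>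

locale c0_involution =
  fixes \<theta> :: "'a::t2_space \<Rightarrow> 'a"
  assumes locally_compact: "locally compact (UNIV :: 'a set)"
    and homeo: "homeomorphism UNIV UNIV \<theta> (inv \<theta>)"
    and invol: "\<theta> \<circ> \<theta> = id"
begin

abbreviation \<gamma> :: "'a c0 \<Rightarrow> 'a c0" where
  "\<gamma> \<equiv> pullback \<theta>"

lemma involutive [simp]: "\<theta> (\<theta> x) = x"
  using invol by (simp add: pointfree_idE)

lemma apply_\<gamma> [simp]: "apply_c0 (\<gamma> f) x = apply_c0 f (\<theta> x)"
  by (simp add: apply_pullback[OF homeo])

lemma \<gamma>_mult: "\<gamma> (f * g) = \<gamma> f * \<gamma> g"
  and \<gamma>_\<gamma> [simp]: "\<gamma> (\<gamma> f) = f"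
  by (auto intro!: c0_eqI)

lemma even_at: "\<gamma> f = f \<Longrightarrow> apply_c0 f (\<theta> x) = apply_c0 f x"
  by (metis apply_\<gamma>)

lemma nonneg_c0_\<gamma>: "nonneg_c0 f \<Longrightarrow> nonneg_c0 (\<gamma> f)"
  by (simp add: nonneg_c0_def)

lemma norm_\<gamma>_le: "norm (\<gamma> f) \<le> norm f"
  by (rule norm_c0_least) (simp add: norm_c0_upper)

text \<open>Joins a bump with its reflection. The average would be even too, but its value at
  \<open>x\<close> could drop below 1.\<close>

lemma exists_even_bump:
  obtains h where "nonneg_c0 h" "norm h \<le> 1" "\<gamma> h = h" "apply_c0 h x = 1"
proof -
  obtain h where h: "nonneg_c0 h" "norm h \<le> 1" "apply_c0 h x = 1"
    using exists_bump[OF locally_compact] .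
  define k where "k = h + \<gamma> h - h * \<gamma> h"
  note join = nonneg_c0_join[OF h(1,2) nonneg_c0_\<gamma>[OF h(1)] order_trans[OF norm_\<gamma>_le h(2)],
      folded k_def]
  show ?thesis
  proof
    show "nonneg_c0 k" using nonneg_c0_add[OF join(2) h(1)] by simp
    show "norm k \<le> 1" by (rule join)
    show "\<gamma> k = k" by (rule c0_eqI) (simp add: k_def algebra_simps)
    show "apply_c0 k x = 1" by (simp add: k_def h(3))
  qed
qed

section \<open>Orbit states are extreme even states\<close>

definition orbit_state :: "'a \<Rightarrow> 'a c0 \<Rightarrow>\<^sub>L complex" where
  "orbit_state x = (1/2) *\<^sub>R (\<delta> x + \<delta> (\<theta> x))"

lemma apply_orbit_state [simp]:
  "blinfun_apply (orbit_state x) f = (apply_c0 f x + apply_c0 f (\<theta> x)) / 2"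
  by (simp add: orbit_state_def blinfun.scaleR_left blinfun.add_left evaluation.rep_eq
      scaleR_conv_of_real)

lemma mem_even_states_iff:
  "\<phi> \<in> even_states \<gamma> \<longleftrightarrow>
     positive_functional \<phi> \<and> norm \<phi> = 1 \<and> (\<forall>f. blinfun_apply \<phi> (\<gamma> f) = \<phi> f)"
  by (auto simp: even_states_def state_iff)

lemma positive_orbit_state: "positive_functional (orbit_state x)"
  by (simp add: positive_functional_def complex_nonneg_Reals_iff algebra_simps
      add_divide_distrib)

lemma orbit_state_even: "orbit_state x \<in> even_states \<gamma>"
proof -
  have "norm (orbit_state x) \<le> 1"
  proof (rule norm_blinfun_bound)
    fix f
    have "cmod (apply_c0 f x + apply_c0 f (\<theta> x)) \<le> norm f + norm f"
      by (intro norm_triangle_le add_mono norm_c0_upper)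
    then show "cmod (blinfun_apply (orbit_state x) f) \<le> 1 * norm f"
      by (simp add: norm_divide)
  qed simp
  moreover have "norm (orbit_state x) \<ge> 1"
  proof -
    obtain h where h: "norm h \<le> 1" "\<gamma> h = h" "apply_c0 h x = 1"
      using exists_even_bump .
    \<comment> \<open>An even bump takes the value 1 at both points of the orbit, so it shows that
      the norm is at least 1.\<close>
    have "1 = cmod (orbit_state x h)" using h even_at by simp
    also have "\<dots> \<le> norm (orbit_state x) * norm h" by (rule norm_blinfun)
    also have "\<dots> \<le> norm (orbit_state x)" using h(1) by (simp add: mult_left_le)
    finally show ?thesis .
  qed
  ultimately show ?thesis
    by (auto simp: mem_even_states_iff positive_orbit_state add.commute)
qed

text \<open>Evaluating at an even bump shows that the factor \<open>k\<close> is real and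
  nonnegative; comparing norms then gives \<open>k = 1\<close>.\<close>

lemma proportional_orbit_state:
  assumes a: "positive_functional a" "norm a = 1"
    and k: "\<And>f. nonneg_c0 f \<Longrightarrow> blinfun_apply a f = k * orbit_state x f"
  shows "a = orbit_state x"
proof -
  obtain h where h: "nonneg_c0 h" "\<gamma> h = h" "apply_c0 h x = 1"
    using exists_even_bump .
  have "a h = k" using k[OF h(1)] h even_at by simp
  then obtain r where r: "k = of_real r" "r \<ge> 0"
    using positive_nonneg[OF a(1) h(1)] by (metis nonneg_Reals_cases)
  have eq: "a = r *\<^sub>R orbit_state x"
  proof (rule positive_eqI[OF a(1)])
    show "positive_functional (r *\<^sub>R orbit_state x)"
      by (intro positive_functional_scaleR positive_orbit_state r)
    show "blinfun_apply a f = (r *\<^sub>R orbit_state x) f" if "nonneg_c0 f" for f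
      using k[OF that] by (simp add: blinfun.scaleR_left scaleR_conv_of_real r)
  qed
  then have "r = 1"
    using a(2) r(2) orbit_state_even[of x] by (simp add: mem_even_states_iff)
  then show ?thesis using eq by simp
qed

text \<open>On a nonnegative function vanishing on the orbit of \<open>x\<close>, both positive
  summands must be zero. So \<open>a\<close> annihilates every function vanishing on the orbit, and
  evenness makes it proportional to the orbit state.\<close>

lemma orbit_state_dominates:
  assumes "orbit_state x = r *\<^sub>R a + Q" "r > 0" "a \<in> even_states \<gamma>" "positive_functional Q"
  shows "a = orbit_state x"
proof -
  have a: "positive_functional a" "norm a = 1" "\<And>f. a (\<gamma> f) = a f"
    using assms(3) by (auto simp: mem_even_states_iff)
  have nonpos: "Re (a f) \<le> 0"
    if "nonneg_c0 f" "apply_c0 f x = 0" "apply_c0 f (\<theta> x) = 0" for f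
  proof -
    have "Re (r *\<^sub>R a f + Q f) = 0"
      using arg_cong[OF assms(1), of "\<lambda>\<psi>. blinfun_apply \<psi> f"] that(2,3)
      by (simp add: blinfun.add_left blinfun.scaleR_left)
    then have "r * Re (a f) + Re (Q f) = 0"
      by simp
    moreover have "Re (Q f) \<ge> 0"
      using positive_nonneg[OF assms(4) that(1)] by (simp add: complex_nonneg_Reals_iff)
    ultimately have "r * Re (a f) \<le> 0" by linarith
    then show ?thesis using assms(2) by (simp add: mult_le_0_iff)
  qed
  have vanish: "a f = 0" if "apply_c0 f x = 0" "apply_c0 f (\<theta> x) = 0" for f
  proof -
    have "Re (a (cabs f)) \<le> 0" using that by (intro nonpos) simp_all
    then have "cmod (a f) \<le> 0" using positive_norm_le_cabs[OF a(1), of f] by linarith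
    then show ?thesis by simp
  qed
  obtain h where h: "\<gamma> h = h" "apply_c0 h x = 1"
    using exists_even_bump .
  have "a f = a h * orbit_state x f" for f
  proof -
    \<comment> \<open>The function \<open>f + \<gamma> f\<close> has the value
      \<open>2 * orbit_state x f\<close> at both \<open>x\<close> and \<open>\<theta> x\<close>,
      which the multiple of \<open>h\<close> cancels. Evenness turns
      \<open>a (f + \<gamma> f)\<close> into \<open>2 * a f\<close>.\<close>
    have "a (f + \<gamma> f - (2 * orbit_state x f) *\<^sub>C h) = 0"
      using h by (intro vanish) (simp_all add: even_at)
    then have "2 * a f = 2 * (a h * orbit_state x f)"
      by (simp only: blinfun.diff_right blinfun.add_right positive_scaleC[OF a(1)] a(3))
        (simp add: algebra_simps)
    then show ?thesis by (simp only: mult_cancel_left) simp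
  qed
  then show ?thesis by (intro proportional_orbit_state a)
qed

lemma orbit_state_extreme: "orbit_state x extreme_point_of even_states \<gamma>"
  unfolding extreme_point_of_def
proof (intro conjI ballI notI orbit_state_even)
  fix a b
  assume ab: "a \<in> even_states \<gamma>" "b \<in> even_states \<gamma>" and "orbit_state x \<in> open_segment a b"
  then obtain u where u: "a \<noteq> b" "0 < u" "u < 1" "orbit_state x = (1 - u) *\<^sub>R a + u *\<^sub>R b"
    by (auto simp: in_segment)
  have pos: "positive_functional a" "positive_functional b"
    using ab by (auto simp: mem_even_states_iff)
  have "a = orbit_state x"
    by (rule orbit_state_dominates[OF u(4)])
      (use u ab pos in \<open>auto intro: positive_functional_scaleR\<close>)
  moreover have "b = orbit_state x"
    by (rule orbit_state_dominates[of x u b "(1 - u) *\<^sub>R a"])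
      (use u ab pos in \<open>auto intro: positive_functional_scaleR\<close>)
  ultimately show False using u(1) by simp
qed

section \<open>Extreme even states are orbit states\<close>

lemma extreme_even_state: "\<phi> extreme_point_of even_states \<gamma> \<Longrightarrow> \<phi> \<in> even_states \<gamma>"
  by (simp add: extreme_point_of_def)

text \<open>Since \<open>norm P + norm Q = norm \<phi> = 1\<close>, the state is a convex
  combination of the normalised summands. Extremality forces these to coincide, and then both equal
  \<open>\<phi>\<close>.\<close>

lemma extreme_dominated:
  assumes ext: "\<phi> extreme_point_of even_states \<gamma>" and sum: "\<phi> = P + Q"
    and P: "positive_functional P" "\<And>f. blinfun_apply P (\<gamma> f) = P f"
    and Q: "positive_functional Q"
  shows "P = norm P *\<^sub>R \<phi>"
proof -
  have \<phi>: "norm \<phi> = 1" "\<And>f. \<phi> (\<gamma> f) = \<phi> f" "\<phi> \<in> even_states \<gamma>"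
    using extreme_even_state[OF ext] by (simp_all add: mem_even_states_iff)
  have Q_even: "Q (\<gamma> f) = Q f" for f
    using \<phi>(2)[of f] P(2)[of f] by (simp add: sum blinfun.add_left)
  have nn: "norm P + norm Q = 1"
    using positive_norm_add[OF P(1) Q] \<phi>(1) sum by simp
  \<comment> \<open>A zero summand cannot be normalised, but then \<open>norm P\<close> is 0 or 1
    and the claim is immediate.\<close>
  consider "P = 0" | "Q = 0" | "norm P > 0" "norm Q > 0" by fastforce
  then show ?thesis
  proof cases
    case 2
    then show ?thesis using nn sum by simp
  next
    case 3
    define a where "a = inverse (norm P) *\<^sub>R P"
    define b where "b = inverse (norm Q) *\<^sub>R Q"
    have ab: "a \<in> even_states \<gamma>" "b \<in> even_states \<gamma>"
      using P Q Q_even 3 by (auto simp: mem_even_states_iff a_def b_def blinfun.scaleR_left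
          intro!: positive_functional_scaleR)
    have "norm P *\<^sub>R a = P" "norm Q *\<^sub>R b = Q"
      using 3 by (auto simp: a_def b_def)
    moreover have nQ: "norm P = 1 - norm Q" using nn by simp
    ultimately have eq: "\<phi> = (1 - norm Q) *\<^sub>R a + norm Q *\<^sub>R b" using sum by simp
    have "\<phi> \<notin> open_segment a b"
      using ext ab unfolding extreme_point_of_def by blast
    moreover have "0 < norm Q" "norm Q < 1" using 3 nQ by auto
    ultimately have "a = b" using eq unfolding in_segment by blast
    then have "\<phi> = a" using eq by (simp flip: scaleR_left_distrib)
    then show ?thesis using \<open>norm P *\<^sub>R a = P\<close> by simp
  qed simp
qed

lemma extreme_multiplicative:
  assumes ext: "\<phi> extreme_point_of even_states \<gamma>" and g: "nonneg_c0 g" "\<gamma> g = g"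
  obtains c :: real where "\<And>f. blinfun_apply \<phi> (g * f) = of_real c * blinfun_apply \<phi> f"
proof (cases "g = 0")
  case True
  then show ?thesis using that[of 0] by simp
next
  case False
  have \<phi>: "positive_functional \<phi>" "\<And>f. \<phi> (\<gamma> f) = \<phi> f"
    using extreme_even_state[OF ext] by (simp_all add: mem_even_states_iff)
  \<comment> \<open>After rescaling, \<open>0 \<le> k \<le> 1\<close> pointwise, so multiplication
    by \<open>k\<close> and by 1 - k both preserve positivity.\<close>
  define k where "k = inverse (norm g) *\<^sub>R g"
  have k: "nonneg_c0 k" "norm k \<le> 1" "\<gamma> k = k"
    using g False even_at[OF g(2)] by (auto simp: k_def intro!: nonneg_c0_scaleR c0_eqI)
  have gk: "g = norm g *\<^sub>R k" using False by (simp add: k_def)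
  define P where "P = \<phi> o\<^sub>L blinfun_mult_right k"
  have P: "P f = \<phi> (k * f)" for f by (simp add: P_def)
  have "P = norm P *\<^sub>R \<phi>"
  proof (rule extreme_dominated[OF ext, of _ "\<phi> - P"])
    show "positive_functional P"
      unfolding positive_functional_def
    proof (intro conjI allI)
      show "P (c *\<^sub>C f) = c * P f" for c f
        by (simp only: P mult_scaleC_right positive_scaleC[OF \<phi>(1)])
      show "P (star f * f) \<in> \<real>\<^sub>\<ge>\<^sub>0" for f
        unfolding P by (intro positive_nonneg[OF \<phi>(1)] nonneg_c0_mult k(1) nonneg_c0_star_mult)
    qed
    show "P (\<gamma> f) = P f" for f
      using \<phi>(2)[of "k * f"] by (simp add: P \<gamma>_mult k(3))
    show "positive_functional (\<phi> - P)"
      unfolding positive_functional_def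
    proof (intro conjI allI)
      show "(\<phi> - P) (c *\<^sub>C f) = c * (\<phi> - P) f" for c f
        by (simp only: blinfun.diff_left P mult_scaleC_right positive_scaleC[OF \<phi>(1)])
          (simp add: algebra_simps)
      fix f
      \<comment> \<open>The complementary functional is \<open>\<phi>\<close> applied after
        multiplication by 1 - k. It is written as \<open>\<phi> - P\<close> because the algebra may
        lack a unit.\<close>
      have "nonneg_c0 (star f * f - k * (star f * f))"
        unfolding nonneg_c0_def
      proof
        fix x
        obtain r where r: "apply_c0 k x = of_real r"
          using nonneg_c0D[OF k(1)] by (metis nonneg_Reals_cases)
        then have "r \<le> 1" using Re_apply_c0_le_norm[of k x] k(2) by simp
        moreover have "apply_c0 (star f * f - k * (star f * f)) x =
            of_real ((1 - r) * (cmod (apply_c0 f x))\<^sup>2)"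
          using complex_norm_square[of "apply_c0 f x"] by (simp add: r algebra_simps)
        ultimately show "apply_c0 (star f * f - k * (star f * f)) x \<in> \<real>\<^sub>\<ge>\<^sub>0"
          by (simp only: nonneg_Reals_of_real_iff) simp
      qed
      then have "\<phi> (star f * f - k * (star f * f)) \<in> \<real>\<^sub>\<ge>\<^sub>0"
        by (rule positive_nonneg[OF \<phi>(1)])
      then show "(\<phi> - P) (star f * f) \<in> \<real>\<^sub>\<ge>\<^sub>0"
        by (simp only: blinfun.diff_left blinfun.diff_right P)
    qed
  qed simp
  then have Pf: "P f = of_real (norm P) * \<phi> f" for f
    by (metis blinfun.scaleR_left scaleR_conv_of_real)
  have "\<phi> (g * f) = of_real (norm g * norm P) * \<phi> f" for f
  proof -
    have "\<phi> (g * f) = norm g *\<^sub>R P f"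
      by (subst gk) (simp add: P blinfun.scaleR_right)
    then show ?thesis by (simp add: Pf scaleR_conv_of_real)
  qed
  then show ?thesis by (rule that)
qed

text \<open>
  At a support point the multiplier of \<open>g\<close> has to be the value of \<open>g\<close>, because
  \<open>\<phi> ((g - c)\<^sup>2 f) = (c\<^sup>2 - 2 c\<^sup>2 + c\<^sup>2) \<phi> f = 0\<close>.
\<close>

lemma extreme_is_orbit_state:
  assumes ext: "\<phi> extreme_point_of even_states \<gamma>"
  obtains x where "\<phi> = orbit_state x"
proof -
  have \<phi>: "positive_functional \<phi>" "norm \<phi> = 1" "\<And>f. \<phi> (\<gamma> f) = \<phi> f"
    using extreme_even_state[OF ext] by (simp_all add: mem_even_states_iff)
  then have "\<phi> \<noteq> 0" by auto
  then obtain x where x: "\<And>g. nonneg_c0 g \<Longrightarrow> \<phi> g = 0 \<Longrightarrow> apply_c0 g x = 0"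
    using positive_support_point[OF \<phi>(1)] by blast
  obtain h where h: "nonneg_c0 h" "\<gamma> h = h" "apply_c0 h x = 1"
    using exists_even_bump .
  have mult: "\<phi> (g * f) = apply_c0 g x * \<phi> f" if g: "nonneg_c0 g" "\<gamma> g = g" for g f
  proof -
    obtain c :: real where c: "\<And>f. \<phi> (g * f) = of_real c * \<phi> f"
      using extreme_multiplicative[OF ext g] by blast
    \<comment> \<open>This is (g - c)^2 h in expanded form. The factor \<open>h\<close> keeps the
      constant term inside the algebra, and \<open>h\<close> being 1 at \<open>x\<close> makes the
      value of \<open>F\<close> there the square of \<open>apply_c0 g x - c\<close>.\<close>
    define F where "F = g * (g * h) - (2 * c) *\<^sub>C (g * h) + (c * c) *\<^sub>C h"
    have F: "apply_c0 F y = (apply_c0 g y - c)\<^sup>2 * apply_c0 h y" for y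
      by (simp add: F_def power2_eq_square algebra_simps)
    have "nonneg_c0 F"
      unfolding nonneg_c0_def
    proof
      fix y
      obtain r s where rs: "apply_c0 g y = of_real r" "apply_c0 h y = of_real s" "s \<ge> 0"
        using nonneg_c0D g(1) h(1) by (metis nonneg_Reals_cases)
      have "apply_c0 F y = of_real ((r - c)\<^sup>2 * s)" by (simp add: F rs)
      then show "apply_c0 F y \<in> \<real>\<^sub>\<ge>\<^sub>0"
        using rs(3) by (simp only: nonneg_Reals_of_real_iff) simp
    qed
    moreover have "\<phi> F = 0"
      by (simp add: F_def blinfun.add_right blinfun.diff_right positive_scaleC[OF \<phi>(1)] c
          algebra_simps)
    ultimately have "apply_c0 F x = 0" by (rule x)
    then have "apply_c0 g x = c" by (simp add: F h(3))
    then show ?thesis using c by simp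
  qed
  \<comment> \<open>The value \<open>\<phi> (h * f)\<close> is computed twice, with \<open>h\<close>
    and with \<open>f\<close> as the multiplier.\<close>
  have even: "\<phi> f = \<phi> h * apply_c0 f x" if f: "nonneg_c0 f" "\<gamma> f = f" for f
    using mult[OF h(1,2), of f] mult[OF f, of h] h(3) by (simp add: mult.commute)
  have "\<phi> f = \<phi> h * orbit_state x f" if f: "nonneg_c0 f" for f
  proof -
    \<comment> \<open>Symmetrising reduces to even functions, and evenness of \<open>\<phi>\<close>
      makes the left side \<open>2 * \<phi> f\<close>.\<close>
    have "\<phi> (f + \<gamma> f) = \<phi> h * apply_c0 (f + \<gamma> f) x"
      by (rule even) (auto intro!: nonneg_c0_add nonneg_c0_\<gamma> f c0_eqI simp: add.commute)
    then show ?thesis by (simp add: blinfun.add_right \<phi>(3) field_simps)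
  qed
  then have "\<phi> = orbit_state x"
    by (rule proportional_orbit_state[OF \<phi>(1,2)])
  then show ?thesis by (rule that)
qed

end

theorem proposition2p5:
  fixes \<theta> :: "'a::t2_space \<Rightarrow> 'a"
  assumes "locally compact (UNIV :: 'a set)"
    and "homeomorphism UNIV UNIV \<theta> (inv \<theta>)"
    and "\<theta> \<circ> \<theta> = id"
  shows "{\<phi>. \<phi> extreme_point_of even_states (pullback \<theta>)}
       = {(1/2) *\<^sub>R (\<delta> x + \<delta> (\<theta> x)) | x. x \<in> UNIV}"
proof -
  interpret c0_involution \<theta> by unfold_locales (fact assms)+
  show ?thesis
    using orbit_state_extreme extreme_is_orbit_state unfolding orbit_state_def by blast
qed

end
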